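(* Let $M=(E,\rho)$ be a matroid and $X\subset Y\subseteq E$ two sets such that $Y$ is a dependent set of full rank ($\rho(Y)=\rho(E)$) and $X$ is an independent set with $\rho(X)<\rho(E)$. Let $k=\rho(E)-\rho(X)$ and $n=|Y-X|$. Then the minor $M|Y/X$ is isomorphic to the uniform matroid $U_n^k$ if and only if (1) $\mathrm{cl}(X)\cap Y=X$, (2) $Y-X\subseteq\mathrm{cyc}(Y)$, and (3) for all $Z\in\mathcal{Z}(M)$, either $Z\cap Y$ is independent or $\mathrm{cl}(X\cup\mathrm{cyc}(Z\cap Y))=E$.
   Context: A matroid $M=(E,\rho)$ is given by its rank function. The closure operator is $\mathrm{cl}(X)=\{e\in E:\rho(X\cup e)=\rho(X)\}$ and the cyclic operator is $\mathrm{cyc}(X)=\{e\in X:\rho(X-e)=\rho(X)\}$. $\mathcal{Z}(M)$ is the set of cyclic flats (sets $X$ with $\mathrm{cl}(X)=\mathrm{cyc}(X)=X$). $M|Y/X$ is the matroid on $Y-X$ with rank function $A\mapsto\rho(A\cup X)-\rho(X)$. $U_n^k$ is the uniform matroid on $n$ elements with rank function $A\mapsto\min\{|A|,k\}$. *)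

theory Defs
  imports Main
begin

record 'a ranked_set =
  ground :: "'a set"
  rk :: "'a set \<Rightarrow> nat"

text \<open>The values of \<^term>\<open>rk M\<close> outside the subsets of \<^term>\<open>ground M\<close> are irrelevant;
  the axioms and the notion of isomorphism only look at subsets of the ground set.\<close>

definition matroid :: "'a ranked_set \<Rightarrow> bool" where
  "matroid M \<longleftrightarrow> finite (ground M) \<and>
     (\<forall>A \<subseteq> ground M. rk M A \<le> card A) \<and>
     (\<forall>A B. A \<subseteq> B \<and> B \<subseteq> ground M \<longrightarrow> rk M A \<le> rk M B) \<and>
     (\<forall>A B. A \<subseteq> ground M \<and> B \<subseteq> ground M \<longrightarrow>
        rk M (A \<union> B) + rk M (A \<inter> B) \<le> rk M A + rk M B)"

definition indep :: "'a ranked_set \<Rightarrow> 'a set \<Rightarrow> bool" where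
  "indep M A \<longleftrightarrow> A \<subseteq> ground M \<and> rk M A = card A"

definition dependent :: "'a ranked_set \<Rightarrow> 'a set \<Rightarrow> bool" where
  "dependent M A \<longleftrightarrow> A \<subseteq> ground M \<and> \<not> indep M A"

definition cl :: "'a ranked_set \<Rightarrow> 'a set \<Rightarrow> 'a set" where
  "cl M A = {e \<in> ground M. rk M (A \<union> {e}) = rk M A}"

definition cyc :: "'a ranked_set \<Rightarrow> 'a set \<Rightarrow> 'a set" where
  "cyc M A = {e \<in> A. rk M (A - {e}) = rk M A}"

definition cyclic_flats :: "'a ranked_set \<Rightarrow> 'a set set" where
  "cyclic_flats M = {A. A \<subseteq> ground M \<and> cl M A = A \<and> cyc M A = A}"

text \<open>The minor \<open>M|Y/X\<close>, for \<open>X \<subseteq> Y \<subseteq> ground M\<close>. When \<^term>\<open>M\<close> is a matroid, monotonicity of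
  the rank makes the subtraction on natural numbers exact.\<close>

definition minor :: "'a ranked_set \<Rightarrow> 'a set \<Rightarrow> 'a set \<Rightarrow> 'a ranked_set" where
  "minor M Y X = \<lparr>ground = Y - X, rk = (\<lambda>A. rk M (A \<union> X) - rk M X)\<rparr>"

text \<open>The uniform matroid of rank \<open>k\<close> on \<open>n\<close> elements, for \<open>k \<le> n\<close>.\<close>

definition uniform_matroid :: "nat \<Rightarrow> nat \<Rightarrow> nat ranked_set" where
  "uniform_matroid n k = \<lparr>ground = {..<n}, rk = (\<lambda>A. min (card A) k)\<rparr>"

definition matroid_isomorphic :: "'a ranked_set \<Rightarrow> 'b ranked_set \<Rightarrow> bool" where
  "matroid_isomorphic M N \<longleftrightarrow>
     (\<exists>f. bij_betw f (ground M) (ground N) \<and> (\<forall>A \<subseteq> ground M. rk N (f ` A) = rk M A))"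

lemma matroid_minor:
  assumes M: "matroid M" and "X \<subseteq> Y" "Y \<subseteq> ground M"
  shows "matroid (minor M Y X)"
proof -
  have fin: "finite (ground M)"
    and bound: "\<And>A. A \<subseteq> ground M \<Longrightarrow> rk M A \<le> card A"
    and mono: "\<And>A B. A \<subseteq> B \<Longrightarrow> B \<subseteq> ground M \<Longrightarrow> rk M A \<le> rk M B"
    and sub: "\<And>A B. A \<subseteq> ground M \<Longrightarrow> B \<subseteq> ground M \<Longrightarrow>
        rk M (A \<union> B) + rk M (A \<inter> B) \<le> rk M A + rk M B"
    using M unfolding matroid_def by blast+
  have X: "X \<subseteq> ground M" using assms by blast
  have le: "rk M X \<le> rk M (A \<union> X)" if "A \<subseteq> Y - X" for A
    using that assms by (intro mono) auto
  have "rk M (A \<union> X) - rk M X \<le> card A" if "A \<subseteq> Y - X" for A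
  proof -
    have A: "A \<subseteq> ground M" using that assms by blast
    show ?thesis using sub[OF A X] bound[OF A] by linarith
  qed
  moreover have "rk M (A \<union> X) - rk M X \<le> rk M (B \<union> X) - rk M X"
    if "A \<subseteq> B" "B \<subseteq> Y - X" for A B
    using that assms by (intro diff_le_mono mono) auto
  moreover have "(rk M ((A \<union> B) \<union> X) - rk M X) + (rk M ((A \<inter> B) \<union> X) - rk M X)
      \<le> (rk M (A \<union> X) - rk M X) + (rk M (B \<union> X) - rk M X)"
    if "A \<subseteq> Y - X" "B \<subseteq> Y - X" for A B
  proof -
    have "rk M ((A \<union> X) \<union> (B \<union> X)) + rk M ((A \<union> X) \<inter> (B \<union> X))
        \<le> rk M (A \<union> X) + rk M (B \<union> X)"
      using that assms by (intro sub) auto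
    moreover have "(A \<union> X) \<union> (B \<union> X) = (A \<union> B) \<union> X" "(A \<union> X) \<inter> (B \<union> X) = (A \<inter> B) \<union> X"
      by auto
    ultimately have "rk M ((A \<union> B) \<union> X) + rk M ((A \<inter> B) \<union> X) \<le> rk M (A \<union> X) + rk M (B \<union> X)"
      by simp
    moreover have "A \<union> B \<subseteq> Y - X" "A \<inter> B \<subseteq> Y - X" using that by auto
    ultimately show ?thesis
      using le[of A] le[of B] le[of "A \<union> B"] le[of "A \<inter> B"] that by linarith
  qed
  moreover have "finite (Y - X)"
    using fin assms by (meson finite_Diff finite_subset)
  ultimately show ?thesis by (simp add: matroid_def minor_def)
qed

lemma matroid_uniform: "matroid (uniform_matroid n k)"
proof -
  have "min (card (A \<union> B)) k + min (card (A \<inter> B)) k \<le> min (card A) k + min (card B) k"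
    if "A \<subseteq> {..<n}" "B \<subseteq> {..<n}" for A B :: "nat set"
  proof -
    have f: "finite A" "finite B" using that finite_subset by blast+
    have "card A + card B = card (A \<union> B) + card (A \<inter> B)" using f by (rule card_Un_Int)
    moreover have "card (A \<inter> B) \<le> card A" "card (A \<inter> B) \<le> card B"
      using f by (auto intro: card_mono)
    ultimately show ?thesis by linarith
  qed
  moreover have "min (card A) k \<le> min (card B) k" if "A \<subseteq> B" "B \<subseteq> {..<n}" for A B :: "nat set"
    using card_mono[of B A] that finite_subset[of B "{..<n}"] by auto
  ultimately show ?thesis unfolding matroid_def uniform_matroid_def by simp
qed

end

(* X is independent of rank \<rho>(E) - k, so the minor is uniform of rank k exactly if every set
   between X and Y is independent or spanning.
   If this holds and the trace D of a cyclic flat on Y is dependent, then D contains a circuit,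
   hence so does cyc D, and X \<union> cyc D is dependent and thus spanning.
   Conversely, assume (3): if X \<subseteq> D \<subseteq> Y and D contains a circuit C, then cl C
   is a cyclic flat whose trace on Y is dependent, so X \<union> cl C spans, and hence so does D. *)

theory Submission
  imports Defs
begin

context
  fixes M :: "'a ranked_set"
  assumes matroid: "matroid M"
begin

section \<open>Rank axioms and dependent sets\<close>

lemma finite_ground: "finite (ground M)"
  using matroid by (simp add: matroid_def)

lemma rk_le_card: "A \<subseteq> ground M \<Longrightarrow> rk M A \<le> card A"
  using matroid by (simp add: matroid_def)

lemma rk_mono: "A \<subseteq> B \<Longrightarrow> B \<subseteq> ground M \<Longrightarrow> rk M A \<le> rk M B"
  using matroid unfolding matroid_def by blast

lemma rk_submodular:
  "A \<subseteq> ground M \<Longrightarrow> B \<subseteq> ground M \<Longrightarrow> rk M (A \<union> B) + rk M (A \<inter> B) \<le> rk M A + rk M B"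
  using matroid by (simp add: matroid_def)

lemma dependent_iff_rk_less_card: "dependent M A \<longleftrightarrow> A \<subseteq> ground M \<and> rk M A < card A"
  using rk_le_card[of A] by (auto simp: dependent_def indep_def)

text \<open>By submodularity, adding \<open>B - A\<close> raises the rank by at most its
  cardinality, so the deficit of rank against cardinality persists in \<open>B\<close>.\<close>

lemma dependent_mono:
  assumes "dependent M A" "A \<subseteq> B" "B \<subseteq> ground M"
  shows "dependent M B"
proof -
  have A: "A \<subseteq> ground M" "rk M A < card A"
    using assms(1) by (auto simp: dependent_iff_rk_less_card)
  have "finite B" using assms(3) finite_ground finite_subset by blast
  then have card: "card B = card A + card (B - A)"
    using assms(2) card_Diff_subset[of A B] card_mono[of B A] finite_subset[of A B] by simp
  have "rk M (A \<union> (B - A)) \<le> rk M A + rk M (B - A)"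
    using rk_submodular[of A "B - A"] assms(3) A(1) by (auto intro: add_leD1)
  moreover have "A \<union> (B - A) = B" using assms(2) by blast
  moreover have "rk M (B - A) \<le> card (B - A)"
    using assms(3) by (intro rk_le_card) auto
  ultimately show ?thesis
    using A(2) assms(3) card by (simp add: dependent_iff_rk_less_card)
qed

text \<open>Diminishing returns: submodularity bounds the gain from adding \<open>e\<close> to
  \<open>B\<close> by the gain over the smaller set \<open>A\<close>. Monotonicity of both
  \<open>cl\<close> and \<open>cyc\<close> rests on this.\<close>

lemma rk_insert_eq_mono:
  assumes "rk M (insert e A) = rk M A" "A \<subseteq> B" "B \<subseteq> ground M" "e \<in> ground M"
  shows "rk M (insert e B) = rk M B"
proof (cases "e \<in> B")
  case True
  then show ?thesis by (simp add: insert_absorb)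
next
  case False
  then have "insert e A \<union> B = insert e B" "insert e A \<inter> B = A"
    using assms(2) by auto
  then have "rk M (insert e B) \<le> rk M B"
    using rk_submodular[of "insert e A" B] assms by auto
  moreover have "rk M B \<le> rk M (insert e B)"
    using assms by (intro rk_mono) auto
  ultimately show ?thesis by simp
qed

section \<open>Closure operator\<close>

lemma cl_subset_ground: "cl M A \<subseteq> ground M"
  by (auto simp: cl_def)

lemma subset_cl: "A \<subseteq> ground M \<Longrightarrow> A \<subseteq> cl M A"
  by (auto simp: cl_def insert_absorb)

lemma cl_mono:
  assumes "A \<subseteq> B" "B \<subseteq> ground M"
  shows "cl M A \<subseteq> cl M B"
  using assms rk_insert_eq_mono by (fastforce simp: cl_def)

text \<open>The elements of \<open>B\<close> are added one at a time; each gains nothing over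
  \<open>A\<close>, hence nothing over the larger set reached so far.\<close>

lemma rk_Un_subset_cl:
  assumes "A \<subseteq> ground M" "B \<subseteq> cl M A"
  shows "rk M (A \<union> B) = rk M A"
proof -
  have "finite B"
    using assms(2) cl_subset_ground finite_ground by (blast intro: finite_subset)
  then show ?thesis using assms(2)
  proof (induction B rule: finite_induct)
    case empty
    then show ?case by simp
  next
    case (insert e B)
    have "e \<in> ground M" "rk M (insert e A) = rk M A"
      using insert.prems by (simp_all add: cl_def)
    moreover have "A \<union> B \<subseteq> ground M"
      using insert.prems assms(1) cl_subset_ground by blast
    ultimately have "rk M (insert e (A \<union> B)) = rk M (A \<union> B)"
      by - (rule rk_insert_eq_mono[of e A]; auto)
    then show ?case using insert by simp
  qed
qed

lemma rk_cl:
  assumes "A \<subseteq> ground M"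
  shows "rk M (cl M A) = rk M A"
  using rk_Un_subset_cl[OF assms order_refl] subset_cl[OF assms] by (simp add: Un_absorb1)

text \<open>If \<open>e\<close> gains nothing over \<open>cl M A\<close>, then the rank of
  \<open>insert e A\<close> is squeezed between \<open>rk M A\<close> and
  \<open>rk M (insert e (cl M A))\<close>, which are equal.\<close>

lemma cl_cl:
  assumes "A \<subseteq> ground M"
  shows "cl M (cl M A) = cl M A"
proof
  show "cl M (cl M A) \<subseteq> cl M A"
  proof
    fix e assume e: "e \<in> cl M (cl M A)"
    then have "e \<in> ground M" by (simp add: cl_def)
    moreover have "rk M (insert e (cl M A)) = rk M A"
      using e rk_cl[OF assms] by (subst (asm) cl_def) simp
    moreover have "rk M (insert e A) \<le> rk M (insert e (cl M A))"
      using calculation(1) subset_cl[OF assms] cl_subset_ground by (intro rk_mono) auto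
    moreover have "rk M A \<le> rk M (insert e A)"
      using calculation(1) assms by (intro rk_mono) auto
    ultimately show "e \<in> cl M A" by (simp add: cl_def)
  qed
qed (use subset_cl cl_subset_ground in blast)

lemma cl_eq_ground_iff:
  assumes "A \<subseteq> ground M"
  shows "cl M A = ground M \<longleftrightarrow> rk M A = rk M (ground M)"
proof
  assume "cl M A = ground M"
  then show "rk M A = rk M (ground M)" using rk_cl[OF assms] by simp
next
  assume eq: "rk M A = rk M (ground M)"
  have "rk M (A \<union> {e}) = rk M A" if "e \<in> ground M" for e
    using rk_mono[of A "A \<union> {e}"] rk_mono[of "A \<union> {e}" "ground M"] that assms eq
    by (simp add: subset_insertI)
  then show "cl M A = ground M" by (auto simp: cl_def)
qed

section \<open>Cyclic operator, cyclic flats and circuits\<close>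

lemma cyc_subset: "cyc M A \<subseteq> A"
  by (auto simp: cyc_def)

text \<open>Membership of \<open>e\<close> in \<open>cyc M A\<close> means zero gain over
  \<open>A - {e}\<close>, and this passes to \<open>B - {e}\<close>.\<close>

lemma cyc_mono:
  assumes "A \<subseteq> B" "B \<subseteq> ground M"
  shows "cyc M A \<subseteq> cyc M B"
proof
  fix e assume e: "e \<in> cyc M A"
  then have "e \<in> A" "rk M (insert e (A - {e})) = rk M (A - {e})"
    by (auto simp: cyc_def insert_absorb)
  then have "rk M (insert e (B - {e})) = rk M (B - {e})"
    using assms by - (rule rk_insert_eq_mono[of e "A - {e}"]; auto)
  then show "e \<in> cyc M B"
    using \<open>e \<in> A\<close> assms by (auto simp: cyc_def insert_absorb)
qed

text \<open>Elements of \<open>A\<close> stay cyclic by monotonicity. Deleting any other element of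
  \<open>cl M A\<close> leaves \<open>A\<close> inside, which already has the full rank of the
  closure.\<close>

lemma cl_cyclic_in_cyclic_flats:
  assumes "A \<subseteq> ground M" "cyc M A = A"
  shows "cl M A \<in> cyclic_flats M"
proof -
  have "e \<in> cyc M (cl M A)" if e: "e \<in> cl M A" for e
  proof (cases "e \<in> A")
    case True
    then show ?thesis
      using cyc_mono[OF subset_cl[OF assms(1)] cl_subset_ground] assms(2) by blast
  next
    case False
    then have "rk M A \<le> rk M (cl M A - {e})"
      using subset_cl[OF assms(1)] cl_subset_ground by (intro rk_mono) auto
    moreover have "rk M (cl M A - {e}) \<le> rk M (cl M A)"
      using cl_subset_ground by (intro rk_mono) auto
    ultimately show ?thesis using e rk_cl[OF assms(1)] by (simp add: cyc_def)
  qed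
  then show ?thesis
    using cl_cl[OF assms(1)] cl_subset_ground cyc_subset unfolding cyclic_flats_def by blast
qed

text \<open>The witness is a circuit, that is, an inclusion-minimal dependent subset: deleting a
  point leaves an independent set of \<open>card C - 1\<close> elements, and \<open>rk M C\<close>
  is no larger than that.\<close>

lemma dependent_contains_cyclic:
  assumes "dependent M A"
  obtains C where "C \<subseteq> A" "dependent M C" "cyc M C = C"
proof -
  have "finite A"
    using assms finite_ground finite_subset unfolding dependent_def by blast
  then obtain C where C: "C \<subseteq> A" "dependent M C"
    and min: "\<And>D. D \<subseteq> C \<Longrightarrow> dependent M D \<Longrightarrow> D = C"
    using finite_has_minimal2[of "{C. C \<subseteq> A \<and> dependent M C}" A] assms
    by (auto dest: order_trans)
  have C': "C \<subseteq> ground M" "rk M C < card C"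
    using C(2) by (auto simp: dependent_iff_rk_less_card)
  have "e \<in> cyc M C" if e: "e \<in> C" for e
  proof -
    have sub: "C - {e} \<subseteq> ground M" using C'(1) by blast
    have "\<not> dependent M (C - {e})" using min[of "C - {e}"] e by blast
    then have "rk M (C - {e}) = card C - 1"
      using sub e by (simp add: dependent_def indep_def)
    moreover have "rk M (C - {e}) \<le> rk M C" using C'(1) by (intro rk_mono) auto
    ultimately show ?thesis using C'(2) e by (simp add: cyc_def)
  qed
  then show thesis using that[OF C] cyc_subset by blast
qed

text \<open>A circuit \<open>C\<close> inside \<open>A\<close> survives in \<open>cyc M A\<close>,
  because \<open>C = cyc M C\<close> and \<open>cyc\<close> is monotone.\<close>

lemma dependent_cyc:
  assumes "dependent M A"
  shows "dependent M (cyc M A)"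
proof -
  obtain C where C: "C \<subseteq> A" "dependent M C" "cyc M C = C"
    using dependent_contains_cyclic[OF assms] by blast
  have A: "A \<subseteq> ground M" using assms by (simp add: dependent_def)
  show ?thesis
    using C cyc_mono[OF C(1) A] cyc_subset A by (intro dependent_mono[OF C(2)]) blast+
qed

text \<open>This turns condition (3) into a statement about the sets between \<open>X\<close> and
  \<open>Y\<close>, the form in which uniformity of the minor is tested.\<close>

lemma cyc_trace_spanning_iff:
  assumes "X \<subseteq> Y" "Y \<subseteq> ground M"
  shows "(\<forall>Z \<in> cyclic_flats M.
            indep M (Z \<inter> Y) \<or> cl M (X \<union> cyc M (Z \<inter> Y)) = ground M) \<longleftrightarrow>
         (\<forall>D. X \<subseteq> D \<and> D \<subseteq> Y \<longrightarrow> indep M D \<or> rk M D = rk M (ground M))"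
    (is "?flats \<longleftrightarrow> ?between")
proof
  assume flats: ?flats
  show ?between
  proof (intro allI impI)
    fix D assume D: "X \<subseteq> D \<and> D \<subseteq> Y"
    then have DE: "D \<subseteq> ground M" using assms by blast
    show "indep M D \<or> rk M D = rk M (ground M)"
      unfolding disj_imp
    proof
      assume "\<not> indep M D"
      then obtain C where C: "C \<subseteq> D" "dependent M C" "cyc M C = C"
        using dependent_contains_cyclic DE unfolding dependent_def by metis
      have CE: "C \<subseteq> ground M" using C(1) DE by blast
      have "dependent M (cl M C \<inter> Y)"
        using subset_cl[OF CE] C(1) D cl_subset_ground by (intro dependent_mono[OF C(2)]) auto
      then have spans: "cl M (X \<union> cyc M (cl M C \<inter> Y)) = ground M"
        using flats cl_cyclic_in_cyclic_flats[OF CE C(3)] unfolding dependent_def by blast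
      \<comment> \<open>Both \<open>X\<close> and \<open>cl M C\<close> lie in
        \<open>cl M D\<close>; closing once more adds nothing to \<open>cl M D\<close>, so it must
        be the whole ground set.\<close>
      have "X \<union> cyc M (cl M C \<inter> Y) \<subseteq> cl M D"
        using D cl_mono[OF C(1) DE] subset_cl[OF DE] cyc_subset by blast
      from cl_mono[OF this cl_subset_ground] have "ground M \<subseteq> cl M D"
        by (simp add: spans cl_cl[OF DE])
      then show "rk M D = rk M (ground M)"
        using cl_eq_ground_iff[OF DE] cl_subset_ground by blast
    qed
  qed
next
  assume between: ?between
  show ?flats
    unfolding disj_imp
  proof (intro ballI impI)
    fix Z assume "\<not> indep M (Z \<inter> Y)"
    then have "dependent M (cyc M (Z \<inter> Y))"
      using assms(2) by (intro dependent_cyc) (auto simp: dependent_def)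
    moreover have sub: "X \<union> cyc M (Z \<inter> Y) \<subseteq> Y" using assms(1) cyc_subset by blast
    \<comment> \<open>This set lies between \<open>X\<close> and \<open>Y\<close>, so its dependence
      leaves only the spanning alternative of \<open>between\<close>.\<close>
    ultimately have "dependent M (X \<union> cyc M (Z \<inter> Y))"
      using assms(2) by - (rule dependent_mono[of "cyc M (Z \<inter> Y)"]; auto)
    then have "rk M (X \<union> cyc M (Z \<inter> Y)) = rk M (ground M)"
      using between sub unfolding dependent_def by blast
    then show "cl M (X \<union> cyc M (Z \<inter> Y)) = ground M"
      using cl_eq_ground_iff sub assms(2) by (metis order_trans)
  qed
qed

end

section \<open>Uniform minors\<close>

lemma isomorphic_uniform_iff:
  fixes N :: "'a ranked_set"
  assumes "finite (ground N)"
  shows "matroid_isomorphic N (uniform_matroid (card (ground N)) k) \<longleftrightarrow>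
         (\<forall>A \<subseteq> ground N. rk N A = min (card A) k)"
proof
  assume "matroid_isomorphic N (uniform_matroid (card (ground N)) k)"
  then obtain f :: "'a \<Rightarrow> nat" where f: "inj_on f (ground N)"
    "\<And>A. A \<subseteq> ground N \<Longrightarrow> min (card (f ` A)) k = rk N A"
    unfolding matroid_isomorphic_def uniform_matroid_def bij_betw_def
    by (auto simp del: ex_simps)
  then show "\<forall>A \<subseteq> ground N. rk N A = min (card A) k"
    by (metis card_image inj_on_subset)
next
  assume rk: "\<forall>A \<subseteq> ground N. rk N A = min (card A) k"
  obtain f where f: "bij_betw f (ground N) {..<card (ground N)}"
    using ex_bij_betw_finite_nat[OF assms] by (auto simp: atLeast0LessThan)
  have "min (card (f ` A)) k = rk N A" if "A \<subseteq> ground N" for A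
    using rk that f by (metis bij_betw_def card_image inj_on_subset)
  then show "matroid_isomorphic N (uniform_matroid (card (ground N)) k)"
    using f unfolding matroid_isomorphic_def uniform_matroid_def by auto
qed

theorem theorem4p7:
  fixes M :: "'a ranked_set" and X Y :: "'a set" and k n :: nat
  assumes "matroid M"
    and "X \<subset> Y" and "Y \<subseteq> ground M"
    and "dependent M Y" and "rk M Y = rk M (ground M)"
    and "indep M X" and "rk M X < rk M (ground M)"
    and "k = rk M (ground M) - rk M X"
    and "n = card (Y - X)"
  shows "matroid_isomorphic (minor M Y X) (uniform_matroid n k) \<longleftrightarrow>
      cl M X \<inter> Y = X
    \<and> Y - X \<subseteq> cyc M Y
    \<and> (\<forall>Z \<in> cyclic_flats M.
          indep M (Z \<inter> Y) \<or> cl M (X \<union> cyc M (Z \<inter> Y)) = ground M)"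
proof -
  note M = assms(1)
  have finY: "finite Y" using finite_ground[OF M] assms(3) finite_subset by blast
  have finX: "finite X" using finY assms(2) finite_subset by blast
  have XE: "X \<subseteq> ground M" using assms(2,3) by blast
  have rX: "rk M X = card X" using assms(6) by (simp add: indep_def)
  have k: "rk M (ground M) = card X + k" "0 < k" using assms(7,8) rX by auto
  have card: "card (X \<union> A) = card X + card A" if "A \<subseteq> Y - X" for A
    using that finX finY finite_subset[of A Y] by (intro card_Un_disjoint) auto
  have "card Y = card X + n"
    using card[of "Y - X"] assms(2,9) by (simp add: Un_absorb1 less_imp_le)
  \<comment> \<open>\<open>Y\<close> has \<open>card X + n\<close> elements but, being dependent of
    full rank, only rank \<open>card X + k\<close>. Strictness allows one element of
    \<open>Y - X\<close> to be deleted later.\<close>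
  then have kn: "k < n"
    using assms(4,5) k(1) by (simp add: dependent_iff_rk_less_card[OF M])
  have le: "rk M X \<le> rk M (X \<union> A)" "rk M (X \<union> A) \<le> card X + k" if "A \<subseteq> Y - X" for A
    using that assms(2,3) rk_mono[OF M, of X "X \<union> A"]
      rk_mono[OF M, of "X \<union> A" "ground M"] k(1) by auto
  have fin: "finite (ground (minor M Y X))" using finY by (simp add: minor_def)
  have iso: "matroid_isomorphic (minor M Y X) (uniform_matroid n k) \<longleftrightarrow>
      (\<forall>A \<subseteq> Y - X. rk M (X \<union> A) - rk M X = min (card A) k)"
    using isomorphic_uniform_iff[OF fin, of k] assms(9) by (simp add: minor_def Un_commute)
  also have "\<dots> \<longleftrightarrow> (\<forall>A \<subseteq> Y - X. rk M (X \<union> A) = card X + min (card A) k)"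
  proof -
    \<comment> \<open>Natural subtraction is exact here since
      \<open>rk M X \<le> rk M (X \<union> A)\<close>.\<close>
    have "rk M (X \<union> A) - rk M X = min (card A) k \<longleftrightarrow> rk M (X \<union> A) = card X + min (card A) k"
      if "A \<subseteq> Y - X" for A
      using le(1)[OF that] rX by linarith
    then show ?thesis by blast
  qed
  finally have uniform: "matroid_isomorphic (minor M Y X) (uniform_matroid n k) \<longleftrightarrow>
      (\<forall>A \<subseteq> Y - X. rk M (X \<union> A) = card X + min (card A) k)" .
  \<comment> \<open>The rank is at most \<open>card X + card A\<close> and at most
    \<open>card X + k\<close>. It equals the minimum exactly if it attains one of the bounds: the
    first means independent, the second spanning.\<close>
  have "rk M (X \<union> A) = card X + min (card A) k \<longleftrightarrow>
      indep M (X \<union> A) \<or> rk M (X \<union> A) = rk M (ground M)" if A: "A \<subseteq> Y - X" for A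
  proof -
    have sub: "X \<union> A \<subseteq> ground M" using A assms(2,3) by blast
    show ?thesis
      using sub card[OF A] rk_le_card[OF M sub] le(2)[OF A] k(1) by (auto simp: indep_def)
  qed
  then have "(\<forall>A \<subseteq> Y - X. rk M (X \<union> A) = card X + min (card A) k) \<longleftrightarrow>
      (\<forall>A \<subseteq> Y - X. indep M (X \<union> A) \<or> rk M (X \<union> A) = rk M (ground M))"
    by blast
  also have "\<dots> \<longleftrightarrow> (\<forall>D. X \<subseteq> D \<and> D \<subseteq> Y \<longrightarrow> indep M D \<or> rk M D = rk M (ground M))"
    (is "_ \<longleftrightarrow> ?between")
  proof
    assume minor: "\<forall>A \<subseteq> Y - X. indep M (X \<union> A) \<or> rk M (X \<union> A) = rk M (ground M)"
    show ?between
    proof (intro allI impI)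
      fix D assume D: "X \<subseteq> D \<and> D \<subseteq> Y"
      then have "D - X \<subseteq> Y - X" "X \<union> (D - X) = D" by auto
      then show "indep M D \<or> rk M D = rk M (ground M)" using minor by metis
    qed
  next
    assume between: ?between
    have "X \<subseteq> X \<union> A" "X \<union> A \<subseteq> Y" if "A \<subseteq> Y - X" for A
      using that assms(2) by auto
    then show "\<forall>A \<subseteq> Y - X. indep M (X \<union> A) \<or> rk M (X \<union> A) = rk M (ground M)"
      using between by simp
  qed
  also have "\<dots> \<longleftrightarrow> (\<forall>Z \<in> cyclic_flats M.
      indep M (Z \<inter> Y) \<or> cl M (X \<union> cyc M (Z \<inter> Y)) = ground M)"
    using cyc_trace_spanning_iff[OF M _ assms(3), of X] assms(2) by (simp add: less_imp_le)
  finally have flats: "matroid_isomorphic (minor M Y X) (uniform_matroid n k) \<longleftrightarrow>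
      (\<forall>Z \<in> cyclic_flats M.
          indep M (Z \<inter> Y) \<or> cl M (X \<union> cyc M (Z \<inter> Y)) = ground M)"
    by (simp only: uniform)
  \<comment> \<open>Conditions (1) and (2) are read off the uniform rank formula, at single elements
    and at complements of single elements in \<open>Y - X\<close>.\<close>
  have "cl M X \<inter> Y = X \<and> Y - X \<subseteq> cyc M Y"
    if "matroid_isomorphic (minor M Y X) (uniform_matroid n k)"
  proof
    have rk: "rk M (X \<union> A) = card X + min (card A) k" if "A \<subseteq> Y - X" for A
      using uniform \<open>matroid_isomorphic _ _\<close> that by blast
    \<comment> \<open>Since \<open>0 < k\<close>, the formula gives \<open>{e}\<close> a gain of 1
      over \<open>X\<close>.\<close>
    have "e \<notin> cl M X" if "e \<in> Y - X" for e
      using rk[of "{e}"] that k(2) rX by (simp add: cl_def)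
    then show "cl M X \<inter> Y = X" using subset_cl[OF M XE] assms(2) by blast
    have "e \<in> cyc M Y" if e: "e \<in> Y - X" for e
    proof -
      have "X \<union> (Y - X - {e}) = Y - {e}" using e assms(2) by blast
      moreover have "card (Y - X - {e}) = n - 1" using e assms(9) by simp
      \<comment> \<open>The remaining \<open>n - 1\<close> elements still number at least
        \<open>k\<close>, so the minimum is \<open>k\<close>.\<close>
      ultimately have "rk M (Y - {e}) = card X + k"
        using rk[of "Y - X - {e}"] kn by auto
      then show ?thesis using e assms(5) k(1) by (simp add: cyc_def)
    qed
    then show "Y - X \<subseteq> cyc M Y" by blast
  qed
  then show ?thesis using flats by blast
qed

end
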